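(* If $H=(V,E)$ is a $3$-uniform, $3$-regular hypergraph, then the graph $H_2$ either has a perfect matching (if $|V|$ is even), or it is factor-critical (if $|V|$ is odd), and in the latter case $V$ can be partitioned into one triangle $\{a,b,c\}\in E$ and a perfect matching of $H_2-\{a,b,c\}$.
   Context: A hypergraph $H=(V,E)$ consists of a vertex set $V$ and a family $E$ of subsets of $V$ called hyperedges, where hyperedges may be present with multiplicities. $H$ is $k$-uniform if all of its hyperedges have $k$ elements, and $k$-regular if every vertex is contained in exactly $k$ hyperedges (counted with multiplicity). A triangle is a hyperedge of cardinality $3$. The graph $H_2=(V,E_2)$ is the simple graph (no loops, no parallel edges) on $V$ whose edges are all $2$-element subsets of hyperedges of $H$. For a graph $G$ and a set $S$ of its vertices, $G-S$ denotes the graph obtained by deleting the vertices in $S$. A matching in a graph is a set of pairwise vertex-disjoint edges; it is perfect if it partitions the vertex set of the graph. A graph $G$ is factor-critical if $G-v$ has a perfect matching for every vertex $v$ of $G$.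
   Formalization: The hypergraph is additionally assumed connected; without this the claim is false, e.g. for two disjoint triangles each taken with multiplicity 3, where |V|=6 but H_2 has no perfect matching. *)

theory Defs
  imports Main "HOL-Library.Multiset" "HOL-Library.Disjoint_Sets"
begin

section \<open>Hypergraphs\<close>

text \<open>A hypergraph is given by its vertex set and its multiset of hyperedges;
  all hypergraphs are finite.\<close>

definition hypergraph :: "'a set \<Rightarrow> 'a set multiset \<Rightarrow> bool" where
  "hypergraph V E \<longleftrightarrow> finite V \<and> (\<forall>e \<in># E. e \<subseteq> V)"

definition uniform :: "nat \<Rightarrow> 'a set multiset \<Rightarrow> bool" where
  "uniform k E \<longleftrightarrow> (\<forall>e \<in># E. card e = k)"

definition hyperdegree :: "'a set multiset \<Rightarrow> 'a \<Rightarrow> nat" where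
  "hyperdegree E v = size {#e \<in># E. v \<in> e#}"

definition regular :: "nat \<Rightarrow> 'a set \<Rightarrow> 'a set multiset \<Rightarrow> bool" where
  "regular k V E \<longleftrightarrow> (\<forall>v \<in> V. hyperdegree E v = k)"

text \<open>Connectivity: any two vertices are joined by a chain of vertices in which
  consecutive ones lie in a common hyperedge.  The empty hypergraph is connected
  under this convention.\<close>

definition hyper_connected :: "'a set \<Rightarrow> 'a set multiset \<Rightarrow> bool" where
  "hyper_connected V E \<longleftrightarrow>
     (\<forall>u \<in> V. \<forall>v \<in> V. (u, v) \<in> {(x, y). \<exists>e \<in># E. x \<in> e \<and> y \<in> e}\<^sup>*)"

definition is_triangle :: "'a set multiset \<Rightarrow> 'a set \<Rightarrow> bool" where
  "is_triangle E t \<longleftrightarrow> t \<in># E \<and> card t = 3"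

section \<open>Simple graphs\<close>

text \<open>A simple graph is a pair of a vertex set and a set of 2-element vertex sets.\<close>

type_synonym 'a graph = "'a set \<times> 'a set set"

definition verts :: "'a graph \<Rightarrow> 'a set" where
  "verts G = fst G"

definition edges :: "'a graph \<Rightarrow> 'a set set" where
  "edges G = snd G"

definition two_graph :: "'a set \<Rightarrow> 'a set multiset \<Rightarrow> 'a graph" where
  "two_graph V E = (V, {f. card f = 2 \<and> (\<exists>e \<in># E. f \<subseteq> e)})"

definition delete_verts :: "'a graph \<Rightarrow> 'a set \<Rightarrow> 'a graph" where
  "delete_verts G S = (verts G - S, {f \<in> edges G. f \<inter> S = {}})"

definition matching :: "'a graph \<Rightarrow> 'a set set \<Rightarrow> bool" where
  "matching G M \<longleftrightarrow> M \<subseteq> edges G \<and> disjoint M"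

definition perfect_matching :: "'a graph \<Rightarrow> 'a set set \<Rightarrow> bool" where
  "perfect_matching G M \<longleftrightarrow> matching G M \<and> partition_on (verts G) M"

definition has_perfect_matching :: "'a graph \<Rightarrow> bool" where
  "has_perfect_matching G \<longleftrightarrow> (\<exists>M. perfect_matching G M)"

definition factor_critical :: "'a graph \<Rightarrow> bool" where
  "factor_critical G \<longleftrightarrow> (\<forall>v \<in> verts G. has_perfect_matching (delete_verts G {v}))"

end

theory Submission
  imports Defs
begin

text \<open>
  Count hyperedges. By double counting, a nonempty proper \<open>A \<subset> V\<close> meets at least
  \<open>card A + 1\<close> hyperedges. No hyperedge meets two components of \<open>H\<^sub>2 - X\<close>, and there are
  \<open>card V\<close> hyperedges, so for \<open>X \<noteq> {}\<close> the number of components plus the number of hyperedges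
  inside \<open>X\<close> is at most \<open>card X\<close>. Tutte's theorem then gives the perfect matching,
  respectively factor-criticality.

  If \<open>H\<^sub>2 - f\<close> has no perfect matching for any hyperedge \<open>f\<close>, then Tutte's theorem yields for
  each \<open>f\<close> a set \<open>X \<supseteq> f\<close> attaining equality: \<open>f\<close> is the only hyperedge inside \<open>X\<close>, and every
  component \<open>C\<close> is odd and tight, that is, it meets exactly \<open>card C + 1\<close> hyperedges. Take a
  minimal odd tight set \<open>K\<close> and a hyperedge \<open>f\<close> with exactly two vertices in \<open>K\<close>. Uncrossing
  \<open>K\<close> with the components belonging to \<open>f\<close> shows that each of them meets \<open>K\<close> in an even set,
  and that \<open>K \<inter> X\<close> is odd and has at most two vertices, which is absurd since
  \<open>f \<inter> K \<subseteq> K \<inter> X\<close>.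

  Tutte's theorem is proved by Anderson's induction through Hall's theorem.
\<close>

section \<open>Hall's theorem\<close>

text \<open>Halmos-Vaughan induction on \<open>card A\<close>. If some nonempty proper
  \<open>B\<close> is tight, \<open>B\<close> and \<open>A - B\<close> are treated separately, the
  latter with the values available to \<open>B\<close> forbidden. Otherwise every nonempty proper
  subset has a spare value, so any choice for one index may be removed.\<close>

theorem hall_marriage:
  fixes S :: "'i \<Rightarrow> 'x set"
  assumes "finite A" and "\<And>a. a \<in> A \<Longrightarrow> finite (S a)"
    and "\<And>B. B \<subseteq> A \<Longrightarrow> card B \<le> card (\<Union>(S ` B))"
  shows "\<exists>g. inj_on g A \<and> (\<forall>a\<in>A. g a \<in> S a)"
  using assms
proof (induction "card A" arbitrary: A S rule: less_induct)
  case less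
  note fin = less.prems(1) and finS = less.prems(2) and hall = less.prems(3)
  show ?case
  proof (cases "A = {}")
    case True
    then show ?thesis by simp
  next
    case ne: False
    show ?thesis
    proof (cases "\<exists>B. B \<subset> A \<and> B \<noteq> {} \<and> card B = card (\<Union>(S ` B))")
      case True
      then obtain B where B: "B \<subset> A" "B \<noteq> {}" "card B = card (\<Union>(S ` B))" by blast
      define U where "U = \<Union>(S ` B)"
      have finB: "finite B" using B fin finite_subset by auto
      have finU: "finite U" unfolding U_def using finB finS B by auto
      have "\<exists>g. inj_on g B \<and> (\<forall>a\<in>B. g a \<in> S a)"
      proof (rule less.hyps)
        show "card B < card A" using B fin by (intro psubset_card_mono)
        show "card D \<le> card (\<Union>(S ` D))" if "D \<subseteq> B" for D
          using that B by (intro hall) auto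
      qed (use finB finS B in auto)
      then obtain g where g: "inj_on g B" "\<And>a. a \<in> B \<Longrightarrow> g a \<in> S a" by blast
      have "\<exists>h. inj_on h (A - B) \<and> (\<forall>a\<in>A - B. h a \<in> S a - U)"
      proof (rule less.hyps)
        show "card (A - B) < card A"
          using B fin by (intro psubset_card_mono) auto
        show "card D \<le> card (\<Union>a\<in>D. S a - U)" if D: "D \<subseteq> A - B" for D
        proof -
          have finD: "finite D" using D fin finite_subset by auto
          \<comment> \<open>Hall's condition for \<open>D \<union> B\<close>, with the exact count
            for \<open>B\<close>, leaves enough values outside \<open>U\<close>.\<close>
          have "card D + card B = card (D \<union> B)"
            using D finD finB by (subst card_Un_disjoint) auto
          also have "\<dots> \<le> card (\<Union>(S ` (D \<union> B)))"
            using D B by (intro hall) auto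
          also have "\<Union>(S ` (D \<union> B)) = (\<Union>a\<in>D. S a - U) \<union> U"
            unfolding U_def by auto
          also have "card \<dots> \<le> card (\<Union>a\<in>D. S a - U) + card U"
            by (rule card_Un_le)
          finally show ?thesis using B(3) unfolding U_def by simp
        qed
      qed (use fin finS in auto)
      then obtain h where h: "inj_on h (A - B)" "\<And>a. a \<in> A - B \<Longrightarrow> h a \<in> S a - U" by blast
      define k where "k a = (if a \<in> B then g a else h a)" for a
      have gU: "g a \<in> U" if "a \<in> B" for a using g(2) that unfolding U_def by blast
      have "inj_on k (B \<union> (A - B))"
      proof (subst inj_on_Un, intro conjI)
        show "inj_on k B" using g(1) unfolding k_def inj_on_def by simp
        show "inj_on k (A - B)" using h(1) unfolding k_def inj_on_def by simp
        show "k ` (B - (A - B)) \<inter> k ` (A - B - B) = {}"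
          using gU h(2) unfolding k_def by force
      qed
      then have "inj_on k A" using B(1) by (metis Un_Diff_cancel le_iff_sup psubsetE)
      moreover have "\<forall>a\<in>A. k a \<in> S a" using g(2) h(2) unfolding k_def by auto
      ultimately show ?thesis by blast
    next
      case notight: False
      obtain a where a: "a \<in> A" using ne by blast
      have "card {a} \<le> card (\<Union>(S ` {a}))" using a by (intro hall) auto
      then have "S a \<noteq> {}" by auto
      then obtain x where x: "x \<in> S a" by blast
      have "\<exists>g. inj_on g (A - {a}) \<and> (\<forall>b\<in>A - {a}. g b \<in> S b - {x})"
      proof (rule less.hyps)
        show "card (A - {a}) < card A" using a fin by (meson card_Diff1_less)
        show "card D \<le> card (\<Union>b\<in>D. S b - {x})" if D: "D \<subseteq> A - {a}" for D
        proof (cases "D = {}")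
          case False
          have "D \<subset> A" using D a by auto
          then have "card D \<noteq> card (\<Union>(S ` D))" using False notight by blast
          moreover have "card D \<le> card (\<Union>(S ` D))" using D by (intro hall) auto
          ultimately have "card D < card (\<Union>(S ` D))" by simp
          moreover have "card (\<Union>(S ` D) - {x}) \<ge> card (\<Union>(S ` D)) - 1"
            using diff_card_le_card_Diff[of "{x}" "\<Union>(S ` D)"] by simp
          moreover have "(\<Union>b\<in>D. S b - {x}) = \<Union>(S ` D) - {x}" by auto
          ultimately show ?thesis by simp
        qed simp
      qed (use fin finS in auto)
      then obtain g where g: "inj_on g (A - {a})" "\<And>b. b \<in> A - {a} \<Longrightarrow> g b \<in> S b - {x}" by blast
      have "inj_on (g(a := x)) A"
        using g unfolding inj_on_def by auto
      moreover have "\<forall>b\<in>A. (g(a := x)) b \<in> S b" using g(2) x by auto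
      ultimately show ?thesis by blast
    qed
  qed
qed

section \<open>Tutte's theorem\<close>

definition matchable :: "'a set set \<Rightarrow> 'a set \<Rightarrow> bool" where
  "matchable F V \<longleftrightarrow> (\<exists>M \<subseteq> F. partition_on V M)"

lemma matchable_edge: "f \<in> F \<Longrightarrow> f \<noteq> {} \<Longrightarrow> matchable F f"
  unfolding matchable_def by (rule exI[of _ "{f}"]) (auto simp: partition_on_def)

lemma matchable_UNION:
  assumes "\<And>i. i \<in> I \<Longrightarrow> matchable F (A i)" and "disjoint_family_on A I"
  shows "matchable F (\<Union>i\<in>I. A i)"
proof -
  obtain M where M: "\<And>i. i \<in> I \<Longrightarrow> M i \<subseteq> F \<and> partition_on (A i) (M i)"
    using assms(1) unfolding matchable_def by metis
  have MU: "\<Union>(M i) = A i" and Mne: "{} \<notin> M i" and Md: "disjoint (M i)" if "i \<in> I" for i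
    using M[OF that] unfolding partition_on_def by simp_all
  have "partition_on (\<Union>i\<in>I. A i) (\<Union>i\<in>I. M i)"
  proof (rule partition_onI)
    show "\<Union> (\<Union>i\<in>I. M i) = (\<Union>i\<in>I. A i)" using MU by (auto simp flip: MU)
    show "{} \<notin> (\<Union>i\<in>I. M i)" using Mne by blast
    show "disjnt p q" if pq: "p \<in> (\<Union>i\<in>I. M i)" "q \<in> (\<Union>i\<in>I. M i)" "p \<noteq> q" for p q
    proof -
      obtain i j where ij: "i \<in> I" "j \<in> I" "p \<in> M i" "q \<in> M j" using pq by blast
      show ?thesis
      proof (cases "i = j")
        case True
        then show ?thesis using Md[OF ij(1)] ij pq(3) by (simp add: disjoint_def disjnt_def)
      next
        case False
        then have "A i \<inter> A j = {}" using assms(2) ij by (simp add: disjoint_family_on_def)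
        moreover have "p \<subseteq> A i" "q \<subseteq> A j" using MU ij by blast+
        ultimately show ?thesis unfolding disjnt_def by blast
      qed
    qed
  qed
  moreover have "(\<Union>i\<in>I. M i) \<subseteq> F" using M by (simp add: UN_subset_iff)
  ultimately show ?thesis unfolding matchable_def by (intro exI conjI)
qed

lemma matchable_Un:
  assumes "matchable F A" "matchable F B" "A \<inter> B = {}"
  shows "matchable F (A \<union> B)"
proof -
  have "matchable F (\<Union>i\<in>{True, False}. if i then A else B)"
    by (rule matchable_UNION) (use assms in \<open>auto simp: disjoint_family_on_def\<close>)
  then show ?thesis by (simp add: Un_commute)
qed

text \<open>The members of the family are unions of components of the graph on \<open>V - X\<close>;
  they need not be connected, and they need not cover \<open>V - X\<close>.\<close>

definition odd_separated :: "'a set set \<Rightarrow> 'a set \<Rightarrow> 'a set \<Rightarrow> 'a set set \<Rightarrow> bool" where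
  "odd_separated F V X \<C> \<longleftrightarrow> X \<subseteq> V \<and> disjoint \<C> \<and>
     (\<forall>C\<in>\<C>. C \<subseteq> V - X \<and> odd (card C) \<and>
       (\<forall>f\<in>F. f \<subseteq> V \<longrightarrow> f \<inter> C \<noteq> {} \<longrightarrow> f \<subseteq> C \<union> X))"

lemma odd_separated_finite:
  assumes "odd_separated F V X \<C>" "finite V"
  shows "finite \<C>"
proof -
  have "\<C> \<subseteq> Pow V" using assms(1) unfolding odd_separated_def by blast
  then show ?thesis using assms(2) finite_subset by auto
qed

lemma card_Union_parity:
  assumes "finite \<C>" "disjoint \<C>" "\<And>C. C \<in> \<C> \<Longrightarrow> finite C \<and> odd (card C)"
  shows "even (card (\<Union>\<C>)) \<longleftrightarrow> even (card \<C>)"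
proof -
  have "card (\<Union>\<C>) = (\<Sum>C\<in>\<C>. card C)"
    using assms by (intro card_Union_disjoint) (auto simp: pairwise_def disjoint_def disjnt_def)
  moreover have "even (\<Sum>C\<in>\<C>. card C) \<longleftrightarrow> even (card \<C>)"
  proof -
    have "{C \<in> \<C>. odd (card C)} = \<C>" using assms(3) by blast
    then show ?thesis using assms(1) by (simp add: even_sum_iff)
  qed
  ultimately show ?thesis by simp
qed

text \<open>By parity, the part of \<open>V - X\<close> missed by the family is odd, hence can be added to it.\<close>

lemma odd_separated_extend:
  assumes os: "odd_separated F V X \<C>" and fin: "finite V"
    and par: "odd (card V + card X + card \<C>)"
  shows "\<exists>\<D>. odd_separated F V X \<D> \<and> card \<D> = card \<C> + 1"
proof -
  define R where "R = V - X - \<Union>\<C>"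
  have C: "\<And>C. C \<in> \<C> \<Longrightarrow> C \<subseteq> V - X \<and> odd (card C)" and X: "X \<subseteq> V" and dC: "disjoint \<C>"
    and sep: "\<And>C f. C \<in> \<C> \<Longrightarrow> f \<in> F \<Longrightarrow> f \<subseteq> V \<Longrightarrow> f \<inter> C \<noteq> {} \<Longrightarrow> f \<subseteq> C \<union> X"
    using os unfolding odd_separated_def by blast+
  have finC: "finite \<C>" using os fin odd_separated_finite by blast
  have UC: "\<Union>\<C> \<subseteq> V - X" using C by blast
  have cV: "card V = card X + card (\<Union>\<C>) + card R"
  proof -
    have "card V = card X + card (V - X)"
      using X fin by (metis card_Diff_subset card_mono finite_subset le_add_diff_inverse)
    also have "card (V - X) = card (\<Union>\<C>) + card R"
      unfolding R_def using UC fin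
      by (metis card_Diff_subset card_mono finite_Diff finite_subset le_add_diff_inverse)
    finally show ?thesis by simp
  qed
  have "even (card (\<Union>\<C>)) \<longleftrightarrow> even (card \<C>)"
    by (rule card_Union_parity) (use finC dC C fin finite_subset in blast)+
  then have oR: "odd (card R)" using cV par by auto
  then have Rne: "R \<noteq> {}" by auto
  have RC: "R \<notin> \<C>" using Rne unfolding R_def by blast
  have "odd_separated F V X (insert R \<C>)"
    unfolding odd_separated_def
  proof (intro conjI ballI impI)
    show "disjoint (insert R \<C>)" using dC unfolding R_def disjoint_def by blast
    fix C f assume Cf: "C \<in> insert R \<C>" "f \<in> F" "f \<subseteq> V" "f \<inter> C \<noteq> {}"
    show "f \<subseteq> C \<union> X"
    proof (cases "C = R")
      case False
      then show ?thesis using Cf sep by blast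
    next
      case True
      have "f \<inter> D = {}" if "D \<in> \<C>" for D
        using sep[OF that Cf(2,3)] Cf(4) True that unfolding R_def by blast
      then show ?thesis using True Cf(3) unfolding R_def by blast
    qed
  qed (use X C oR in \<open>auto simp: R_def\<close>)
  then show ?thesis using RC finC by (intro exI[of _ "insert R \<C>"]) auto
qed

text \<open>An excess of exactly one over \<open>card X\<close> has the wrong parity when
  \<open>card V\<close> is even, so \<open>odd_separated_extend\<close> supplies a further
  member.\<close>

lemma odd_separated_plus_two:
  assumes os: "odd_separated F V X \<C>" and fin: "finite V" and ev: "even (card V)"
    and gt: "card X < card \<C>"
  shows "\<exists>\<D>. odd_separated F V X \<D> \<and> card X + 2 \<le> card \<D>"
proof (cases "card \<C> = card X + 1")
  case False
  then show ?thesis using os gt by (intro exI[of _ \<C>]) auto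
next
  case True
  then have "odd (card V + card X + card \<C>)" using ev by simp
  from odd_separated_extend[OF os fin this] show ?thesis using True by auto
qed

text \<open>Induction on \<open>card V\<close>. For a largest \<open>X\<close> attaining equality,
  each member of its family becomes matchable after losing any one vertex, and Hall's theorem pairs
  the members with the vertices of \<open>X\<close>.\<close>

theorem tutte_sufficient:
  assumes "finite V" and "\<And>f. f \<in> F \<Longrightarrow> card f = 2"
    and "\<And>X \<C>. odd_separated F V X \<C> \<Longrightarrow> card \<C> \<le> card X"
  shows "matchable F V"
  using assms
proof (induction "card V" arbitrary: V rule: less_induct)
  case less
  note fin = less.prems(1) and F2 = less.prems(2) and tutte = less.prems(3)
  show ?case
  proof (cases "V = {}")
    case True
    then show ?thesis unfolding matchable_def by (intro exI[of _ "{}"]) (simp add: partition_on_def)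
  next
    case ne: False
    have ev: "even (card V)"
    proof (rule ccontr)
      assume "odd (card V)"
      then have "odd_separated F V {} {V}"
        unfolding odd_separated_def by (simp add: disjoint_def)
      from tutte[OF this] show False by simp
    qed
    define T where "T = {X. \<exists>\<C>. odd_separated F V X \<C> \<and> card \<C> = card X}"
    have TV: "T \<subseteq> Pow V" unfolding T_def odd_separated_def by blast
    obtain v0 where v0: "v0 \<in> V" using ne by blast
    \<comment> \<open>As \<open>card V\<close> is even, a single vertex attains equality, so
      \<open>T\<close> is nonempty.\<close>
    have "odd_separated F V {v0} {V - {v0}}"
      unfolding odd_separated_def using v0 ev fin
      by (auto simp: disjoint_def card_Diff_singleton)
    then have v0T: "{v0} \<in> T" unfolding T_def by auto
    have "finite (card ` T)" using TV fin finite_subset by (intro finite_imageI) auto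
    obtain X where XT: "X \<in> T" and Xmax: "\<And>Y. Y \<in> T \<Longrightarrow> card Y \<le> card X"
    proof -
      have "Max (card ` T) \<in> card ` T" using v0T \<open>finite (card ` T)\<close> by (intro Max_in) auto
      then obtain X where "X \<in> T" "card X = Max (card ` T)" by auto
      then show thesis using that \<open>finite (card ` T)\<close> by auto
    qed
    then obtain \<C> where os: "odd_separated F V X \<C>" and cC: "card \<C> = card X"
      unfolding T_def by blast
    have C: "\<And>C. C \<in> \<C> \<Longrightarrow> C \<subseteq> V - X \<and> odd (card C)" and XV: "X \<subseteq> V" and dC: "disjoint \<C>"
      and sep: "\<And>C f. C \<in> \<C> \<Longrightarrow> f \<in> F \<Longrightarrow> f \<subseteq> V \<Longrightarrow> f \<inter> C \<noteq> {} \<Longrightarrow> f \<subseteq> C \<union> X"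
      using os unfolding odd_separated_def by blast+
    have finC: "finite \<C>" using os fin odd_separated_finite by blast
    have finX: "finite X" using XV fin finite_subset by blast
    have UC: "\<Union>\<C> \<subseteq> V - X" using C by blast
    have Cdisj: "C \<inter> D = {}" if "C \<in> \<C>" "D \<in> \<C>" "C \<noteq> D" for C D
      using dC that by (meson disjoint_def)

    \<comment> \<open>Otherwise move a vertex of the even remainder into \<open>X\<close>; the rest of it is an odd new member.\<close>
    have cover: "V = X \<union> \<Union>\<C>"
    proof (rule ccontr)
      assume "V \<noteq> X \<union> \<Union>\<C>"
      then obtain r where r: "r \<in> V" "r \<notin> X" "r \<notin> \<Union>\<C>" using XV UC by blast
      have oX: "odd_separated F V (insert r X) \<C>"
        unfolding odd_separated_def
      proof (intro conjI ballI impI)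
        fix C f assume "C \<in> \<C>" "f \<in> F" "f \<subseteq> V" "f \<inter> C \<noteq> {}"
        then show "f \<subseteq> C \<union> insert r X" using sep by blast
      qed (use XV C dC r in auto)
      have cr: "card (insert r X) = card X + 1" using r finX by simp
      have "odd (card V + card (insert r X) + card \<C>)" using cr cC ev by simp
      from odd_separated_extend[OF oX fin this] have "insert r X \<in> T"
        unfolding T_def using cr cC by auto
      then show False using Xmax cr by fastforce
    qed

    \<comment> \<open>If \<open>C - {v}\<close> violated Tutte's condition, parity would give an
      excess of two there; adding \<open>v\<close> and that barrier to \<open>X\<close> then yields
      a larger set attaining equality.\<close>
    have critical: "matchable F (C - {v})" if CC: "C \<in> \<C>" and v: "v \<in> C" for C v
    proof (rule less.hyps)
      have CV: "C \<subseteq> V" "C \<inter> X = {}" using C CC by blast+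
      have finCC: "finite C" using CV fin finite_subset by blast
      show "card (C - {v}) < card V"
        using v CV fin by (intro psubset_card_mono) auto
      show "finite (C - {v})" using finCC by simp
      have evC: "even (card (C - {v}))" using C[OF CC] v finCC by (simp add: card_Diff_singleton)
      show "card \<D> \<le> card Y" if oY: "odd_separated F (C - {v}) Y \<D>" for Y \<D>
      proof (rule ccontr)
        assume "\<not> card \<D> \<le> card Y"
        then obtain \<E> where oE: "odd_separated F (C - {v}) Y \<E>" and cE: "card Y + 2 \<le> card \<E>"
          using odd_separated_plus_two[OF oY] finCC evC by auto
        have E: "\<And>D. D \<in> \<E> \<Longrightarrow> D \<subseteq> C - {v} - Y \<and> odd (card D)" and YC: "Y \<subseteq> C - {v}"
          and dE: "disjoint \<E>"
          and sepE: "\<And>D f. D \<in> \<E> \<Longrightarrow> f \<in> F \<Longrightarrow> f \<subseteq> C - {v} \<Longrightarrow> f \<inter> D \<noteq> {} \<Longrightarrow> f \<subseteq> D \<union> Y"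
          using oE unfolding odd_separated_def by blast+
        have finE: "finite \<E>" using odd_separated_finite[OF oE] finCC by simp
        define Z where "Z = insert v (X \<union> Y)"
        define \<G> where "\<G> = (\<C> - {C}) \<union> \<E>"
        have cZ: "card Z = card X + card Y + 1"
        proof -
          have "finite Y" using YC finCC finite_subset by blast
          moreover have "X \<inter> Y = {}" "v \<notin> X \<union> Y" using YC CV v by blast+
          ultimately show ?thesis unfolding Z_def using finX by (simp add: card_Un_disjoint)
        qed
        have Ene: "D \<noteq> {}" if "D \<in> \<E>" for D using E[OF that] by auto
        have CE: "D' \<inter> D = {}" if "D' \<in> \<C> - {C}" "D \<in> \<E>" for D' D
          using Cdisj[of D' C] that CC E[of D] by blast
        have cG: "card \<G> \<ge> card X + card Y + 1"
        proof -
          have "D \<notin> \<E>" if "D \<in> \<C> - {C}" for D using CE[OF that, of D] Ene[of D] by auto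
          then have "(\<C> - {C}) \<inter> \<E> = {}" by (simp add: disjoint_iff)
          then have "card \<G> = card (\<C> - {C}) + card \<E>"
            unfolding \<G>_def using finC finE by (intro card_Un_disjoint) auto
          moreover have "card (\<C> - {C}) + 1 = card \<C>" using CC finC by (metis Suc_eq_plus1 card_Suc_Diff1)
          ultimately show ?thesis using cE cC by simp
        qed
        have oG: "odd_separated F V Z \<G>"
          unfolding odd_separated_def
        proof (intro conjI ballI impI)
          show "Z \<subseteq> V" unfolding Z_def using XV YC CV v by blast
          have "\<Union>(\<C> - {C}) \<inter> \<Union>\<E> = {}"
          proof (rule equals0I)
            fix x assume "x \<in> \<Union>(\<C> - {C}) \<inter> \<Union>\<E>"
            then obtain D' D where "D' \<in> \<C> - {C}" "x \<in> D'" "D \<in> \<E>" "x \<in> D" by blast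
            then show False using CE[of D' D] by blast
          qed
          moreover have "disjoint (\<C> - {C})" using dC by (simp add: disjoint_def)
          ultimately show "disjoint \<G>" unfolding \<G>_def using dE by (intro disjoint_union)
          fix D assume D: "D \<in> \<G>"
          then consider "D \<in> \<C>" "D \<noteq> C" | "D \<in> \<E>" unfolding \<G>_def by blast
          note cases = this
          show "D \<subseteq> V - Z"
            using cases
          proof cases
            case 1
            then have "D \<inter> C = {}" using Cdisj CC by blast
            then show ?thesis using C[of D] 1 YC v unfolding Z_def by blast
          next
            case 2
            then show ?thesis using E[of D] CV unfolding Z_def by blast
          qed
          show "odd (card D)" using cases C E by cases auto
          fix f assume f: "f \<in> F" "f \<subseteq> V" "f \<inter> D \<noteq> {}"
          show "f \<subseteq> D \<union> Z"
            using cases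
          proof cases
            case 1
            then show ?thesis using sep[of D f] f unfolding Z_def by blast
          next
            case 2
            then have DC: "D \<subseteq> C" using E by blast
            then have fC: "f \<subseteq> C \<union> X" using sep[OF CC f(1,2)] f(3) by blast
            show ?thesis
            proof (cases "f \<subseteq> C - {v}")
              case True
              then show ?thesis using sepE[OF 2 f(1) _ f(3)] unfolding Z_def by blast
            next
              case False
              then obtain z where z: "z \<in> f" "z \<in> insert v X" using fC by blast
              obtain d where d: "d \<in> f" "d \<in> D" using f(3) by blast
              \<comment> \<open>An edge has only two vertices; here one is in \<open>D\<close> and
                the other in \<open>Z\<close>.\<close>
              have "z \<noteq> d" using z d E[OF 2] CV by blast
              then have "f = {z, d}" using F2[OF f(1)] z d by (metis card_2_iff doubleton_eq_iff insertE singletonD)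
              then show ?thesis using z d unfolding Z_def by blast
            qed
          qed
        qed
        have "card \<G> = card Z" using tutte[OF oG] cG cZ by simp
        then have "Z \<in> T" unfolding T_def using oG by blast
        then show False using Xmax[of Z] cZ by simp
      qed
    qed (use F2 in auto)

    \<comment> \<open>The neighbours of \<open>C\<close> in \<open>X\<close>. Hall's condition for
      \<open>\<D>\<close> is Tutte's condition for the union of these neighbourhoods, which already
      separates the members of \<open>\<D>\<close>.\<close>
    define S where "S C = {x \<in> X. \<exists>v\<in>C. {v, x} \<in> F}" for C
    have "\<exists>g. inj_on g \<C> \<and> (\<forall>C\<in>\<C>. g C \<in> S C)"
    proof (rule hall_marriage[OF finC])
      show "finite (S C)" for C unfolding S_def using finX by simp
      show "card \<D> \<le> card (\<Union>(S ` \<D>))" if D: "\<D> \<subseteq> \<C>" for \<D>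
      proof (rule tutte)
        show "odd_separated F V (\<Union>(S ` \<D>)) \<D>"
          unfolding odd_separated_def
        proof (intro conjI ballI impI)
          have SX: "\<Union>(S ` \<D>) \<subseteq> X" unfolding S_def by blast
          show "\<Union>(S ` \<D>) \<subseteq> V" using SX XV by blast
          show "disjoint \<D>" using dC D by (meson disjoint_def subsetD)
          fix C assume CD: "C \<in> \<D>"
          show "C \<subseteq> V - \<Union>(S ` \<D>)" using SX C[of C] CD D by blast
          show "odd (card C)" using C CD D by blast
          fix f assume f: "f \<in> F" "f \<subseteq> V" "f \<inter> C \<noteq> {}"
          show "f \<subseteq> C \<union> \<Union>(S ` \<D>)"
          proof
            fix z assume z: "z \<in> f"
            obtain d where d: "d \<in> f" "d \<in> C" using f(3) by blast
            show "z \<in> C \<union> \<Union>(S ` \<D>)"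
            proof (cases "z \<in> C")
              case False
              then have zX: "z \<in> X" using sep[of C f] f z CD D by blast
              have "z \<noteq> d" using False d by blast
              then have "f = {d, z}" using F2[OF f(1)] z d by (metis card_2_iff doubleton_eq_iff insertE singletonD)
              then have "z \<in> S C" unfolding S_def using zX d f(1) by blast
              then show ?thesis using CD by blast
            qed simp
          qed
        qed
      qed
    qed
    then obtain g where g: "inj_on g \<C>" "\<And>C. C \<in> \<C> \<Longrightarrow> g C \<in> S C" by blast
    have "g ` \<C> \<subseteq> X" using g(2) unfolding S_def by blast
    \<comment> \<open>Equality in the counts makes \<open>g\<close> onto \<open>X\<close>, so no
      vertex of \<open>X\<close> is left unmatched.\<close>
    then have gX: "g ` \<C> = X" using finX cC card_image[OF g(1)] by (intro card_subset_eq) auto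
    have "matchable F (\<Union>C\<in>\<C>. insert (g C) C)"
    proof (rule matchable_UNION)
      fix C assume CC: "C \<in> \<C>"
      obtain v where v: "v \<in> C" "{v, g C} \<in> F" using g(2)[OF CC] unfolding S_def by blast
      have "g C \<in> X" using CC gX by blast
      then have "g C \<notin> C" using C[OF CC] by blast
      then have "matchable F ((C - {v}) \<union> {v, g C})"
        using v by (intro matchable_Un critical[OF CC] matchable_edge) auto
      moreover have "(C - {v}) \<union> {v, g C} = insert (g C) C" using v by blast
      ultimately show "matchable F (insert (g C) C)" by simp
    next
      show "disjoint_family_on (\<lambda>C. insert (g C) C) \<C>"
        unfolding disjoint_family_on_def
      proof (intro ballI impI)
        fix C D assume CD: "C \<in> \<C>" "D \<in> \<C>" "C \<noteq> D"
        have "g C \<noteq> g D" using g(1) CD by (meson inj_on_def)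
        moreover have "g C \<in> X" "g D \<in> X" using CD gX by blast+
        ultimately show "insert (g C) C \<inter> insert (g D) D = {}"
          using Cdisj[OF CD] C[OF CD(1)] C[OF CD(2)] by blast
      qed
    qed
    moreover have "(\<Union>C\<in>\<C>. insert (g C) C) = V" using gX cover by blast
    ultimately show ?thesis by simp
  qed
qed

text \<open>The contrapositive of Tutte's condition, with the excess raised to two by parity. The
  second unit matters as soon as deleted vertices join the barrier.\<close>

corollary even_not_matchable:
  assumes "finite V" and "\<And>f. f \<in> F \<Longrightarrow> card f = 2" and "even (card V)" and "\<not> matchable F V"
  obtains X \<C> where "odd_separated F V X \<C>" and "card X + 2 \<le> card \<C>"
proof -
  obtain X \<C> where "odd_separated F V X \<C>" "card X < card \<C>"
    using tutte_sufficient[of V F] assms by (meson not_le)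
  then show thesis using odd_separated_plus_two assms(1,3) that by blast
qed

section \<open>Counting hyperedges\<close>

text \<open>Hyperedges are indexed, so that cardinalities of index sets count multiplicities.\<close>

locale connected_cubic_hypergraph =
  fixes V :: "'a set" and I :: "'i set" and h :: "'i \<Rightarrow> 'a set"
  assumes finV: "finite V" and finI: "finite I"
    and h_sub: "\<And>i. i \<in> I \<Longrightarrow> h i \<subseteq> V"
    and h_card: "\<And>i. i \<in> I \<Longrightarrow> card (h i) = 3"
    and deg: "\<And>v. v \<in> V \<Longrightarrow> card {i \<in> I. v \<in> h i} = 3"
    and conn: "\<And>A. A \<subseteq> V \<Longrightarrow> A \<noteq> {} \<Longrightarrow> A \<noteq> V \<Longrightarrow> \<exists>i\<in>I. h i \<inter> A \<noteq> {} \<and> \<not> h i \<subseteq> A"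
begin

definition inc :: "'a set \<Rightarrow> 'i set" where
  "inc A = {i \<in> I. h i \<inter> A \<noteq> {}}"

lemma inc_sub: "inc A \<subseteq> I"
  unfolding inc_def by blast

lemma fin_inc [simp]: "finite (inc A)"
  using finI inc_sub finite_subset by blast

lemma inc_Un: "inc (A \<union> B) = inc A \<union> inc B"
  unfolding inc_def by blast

lemma inc_mono: "A \<subseteq> B \<Longrightarrow> inc A \<subseteq> inc B"
  unfolding inc_def by blast

lemma fin_sub: "A \<subseteq> V \<Longrightarrow> finite A"
  using finV finite_subset by blast

lemma fin_h: "i \<in> I \<Longrightarrow> finite (h i)"
  using h_sub fin_sub by blast

text \<open>Double counting of the incidences between \<open>A\<close> and the hyperedges. Any index
  set between \<open>inc A\<close> and \<open>I\<close> may be summed over, since hyperedges missing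
  \<open>A\<close> contribute nothing.\<close>

lemma sum_card_Int:
  assumes "A \<subseteq> V" and "inc A \<subseteq> J" and "J \<subseteq> I"
  shows "(\<Sum>i\<in>J. card (h i \<inter> A)) = 3 * card A"
proof -
  have finJ: "finite J" using assms(3) finI finite_subset by blast
  have "(\<Sum>i\<in>J. card (h i \<inter> A)) = (\<Sum>i\<in>J. \<Sum>v\<in>A. if v \<in> h i then 1 else 0)"
    using fin_sub[OF assms(1)]
    by (intro sum.cong refl) (simp add: sum.If_cases Int_def conj_commute)
  also have "\<dots> = (\<Sum>v\<in>A. \<Sum>i\<in>J. if v \<in> h i then 1 else 0)"
    by (rule sum.swap)
  also have "\<dots> = (\<Sum>v\<in>A. 3)"
  proof (intro sum.cong refl)
    fix v assume v: "v \<in> A"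
    have "{i \<in> J. v \<in> h i} = {i \<in> I. v \<in> h i}"
      using assms v unfolding inc_def by blast
    moreover have "(\<Sum>i\<in>J. if v \<in> h i then 1 else 0) = card {i \<in> J. v \<in> h i}"
      using finJ by (simp flip: sum.inter_filter)
    moreover have "v \<in> V" using v assms(1) by blast
    ultimately show "(\<Sum>i\<in>J. if v \<in> h i then 1 else 0) = (3::nat)"
      using deg by simp
  qed
  finally show ?thesis by simp
qed

lemma card_Int_h_le: "i \<in> I \<Longrightarrow> card (h i \<inter> A) \<le> 3"
  using h_card fin_h by (metis card_mono inf_le1)

text \<open>The \<open>3 * card A\<close> incidences are spread over \<open>inc A\<close> with at
  most three per hyperedge; connectedness gives a hyperedge leaving \<open>A\<close>, which carries
  fewer.\<close>

lemma card_inc_gt: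
  assumes "A \<subseteq> V" "A \<noteq> {}" "A \<noteq> V"
  shows "card A < card (inc A)"
proof -
  obtain i where i: "i \<in> I" "h i \<inter> A \<noteq> {}" "\<not> h i \<subseteq> A" using conn assms by blast
  have "3 * card A = (\<Sum>j\<in>inc A. card (h j \<inter> A))"
    using sum_card_Int[OF assms(1) order_refl inc_sub] by simp
  also have "\<dots> < (\<Sum>j\<in>inc A. 3)"
  proof (rule sum_strict_mono_ex1)
    show "\<forall>j\<in>inc A. card (h j \<inter> A) \<le> 3" using card_Int_h_le inc_sub by blast
    have "h i \<inter> A \<subset> h i" using i by blast
    then have "card (h i \<inter> A) < 3" using h_card[OF i(1)] fin_h[OF i(1)] psubset_card_mono by metis
    then show "\<exists>j\<in>inc A. card (h j \<inter> A) < 3" using i unfolding inc_def by blast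
  qed simp
  finally show ?thesis by simp
qed

lemma inc_V: "inc V = I"
proof -
  have "h i \<inter> V \<noteq> {}" if "i \<in> I" for i
  proof -
    have "h i \<noteq> {}" using h_card[OF that] by auto
    then show ?thesis using h_sub[OF that] by blast
  qed
  then show ?thesis unfolding inc_def by blast
qed

lemma card_I: "card I = card V"
proof -
  have "3 * card V = (\<Sum>i\<in>I. card (h i \<inter> V))"
    using sum_card_Int[of V I] inc_V by simp
  also have "\<dots> = (\<Sum>i\<in>I. 3)"
    by (intro sum.cong refl) (metis h_card h_sub inf_absorb1)
  finally show ?thesis by simp
qed

section \<open>Separated families and their surplus of hyperedges\<close>

definition inside :: "'a set \<Rightarrow> 'i set" where
  "inside X = {i \<in> I. h i \<subseteq> X}"

text \<open>The counterpart of \<open>odd_separated\<close> for whole hyperedges. Members are merely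
  nonempty, so an uncovered rest of either parity can be added.\<close>

definition separated :: "'a set \<Rightarrow> 'a set set \<Rightarrow> bool" where
  "separated X \<C> \<longleftrightarrow> X \<subseteq> V \<and> disjoint \<C> \<and>
     (\<forall>C\<in>\<C>. C \<noteq> {} \<and> C \<subseteq> V - X \<and> (\<forall>i\<in>inc C. h i \<subseteq> C \<union> X))"

lemma separated_inc_disjoint:
  assumes "separated X \<C>" "C \<in> \<C>" "D \<in> \<C>" "C \<noteq> D"
  shows "inc C \<inter> inc D = {}"
proof (rule ccontr)
  assume "inc C \<inter> inc D \<noteq> {}"
  then obtain i where i: "i \<in> inc C" "i \<in> inc D" by blast
  have "h i \<subseteq> C \<union> X" "D \<subseteq> V - X" using assms i unfolding separated_def by blast+
  moreover have "C \<inter> D = {}" using assms unfolding separated_def disjoint_def by blast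
  ultimately show False using i unfolding inc_def by blast
qed

lemma separated_inside_disjoint:
  assumes "separated X \<C>" "C \<in> \<C>"
  shows "inside X \<inter> inc C = {}"
  using assms unfolding separated_def inside_def inc_def by blast

lemma separated_finite: "separated X \<C> \<Longrightarrow> finite \<C>"
  by (rule finite_subset[of _ "Pow V"]) (use finV in \<open>auto simp: separated_def\<close>)

text \<open>Each hyperedge lies inside \<open>X\<close> or meets exactly one member, so the left
  side counts \<open>I\<close>; the right side counts \<open>V\<close>, and \<open>card_I\<close>
  equates them.\<close>

lemma separated_cover_sum:
  assumes sep: "separated X \<C>" and cov: "V = X \<union> \<Union>\<C>"
  shows "card (inside X) + (\<Sum>C\<in>\<C>. card (inc C)) = card X + (\<Sum>C\<in>\<C>. card C)"
proof -
  have fin: "finite \<C>" using sep separated_finite by blast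
  have XV: "X \<subseteq> V" and dC: "disjoint \<C>" and CV: "\<And>C. C \<in> \<C> \<Longrightarrow> C \<subseteq> V - X"
    using sep unfolding separated_def by blast+
  have "card V = card X + card (\<Union>\<C>)"
    unfolding cov using fin_sub[OF XV] finV cov CV
    by (intro card_Un_disjoint) (auto intro: fin_sub)
  also have "card (\<Union>\<C>) = (\<Sum>C\<in>\<C>. card C)"
  proof (rule card_Union_disjoint)
    show "pairwise disjnt \<C>" using dC by simp
    show "finite C" if "C \<in> \<C>" for C using CV[OF that] by (intro fin_sub) blast
  qed
  finally have V: "card V = card X + (\<Sum>C\<in>\<C>. card C)" .
  have "i \<in> inside X \<or> i \<in> (\<Union>C\<in>\<C>. inc C)" if i: "i \<in> I" for i
  proof (cases "h i \<subseteq> X")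
    case False
    then obtain C where "C \<in> \<C>" "h i \<inter> C \<noteq> {}" using h_sub[OF i] cov by blast
    then show ?thesis using i unfolding inc_def by blast
  qed (use i in \<open>simp add: inside_def\<close>)
  moreover have "inside X \<union> (\<Union>C\<in>\<C>. inc C) \<subseteq> I" using inc_sub by (auto simp: inside_def)
  ultimately have "I = inside X \<union> (\<Union>C\<in>\<C>. inc C)" by (intro equalityI subsetI) auto
  moreover have "card (inside X \<union> (\<Union>C\<in>\<C>. inc C)) = card (inside X) + card (\<Union>C\<in>\<C>. inc C)"
    using fin finI separated_inside_disjoint[OF sep]
    by (intro card_Un_disjoint) (auto simp: inside_def)
  moreover have "card (\<Union>C\<in>\<C>. inc C) = (\<Sum>C\<in>\<C>. card (inc C))"
    using fin separated_inc_disjoint[OF sep] by (intro card_UN_disjoint) auto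
  ultimately show ?thesis using V card_I by simp
qed

lemma separated_insert_rest:
  assumes sep: "separated X \<C>" and R: "R = V - X - \<Union>\<C>" "R \<noteq> {}"
  shows "separated X (insert R \<C>)"
proof -
  have "h i \<subseteq> R \<union> X" if i: "i \<in> inc R" for i
  proof -
    have "h i \<inter> C = {}" if C: "C \<in> \<C>" for C
    proof (rule ccontr)
      assume "h i \<inter> C \<noteq> {}"
      then have "i \<in> inc C" using i unfolding inc_def by blast
      then have "h i \<subseteq> C \<union> X" using sep C unfolding separated_def by blast
      then show False using i C R unfolding inc_def by blast
    qed
    then show ?thesis using R h_sub[of i] i unfolding inc_def by blast
  qed
  moreover have "disjoint (insert R \<C>)"
    using sep R unfolding separated_def disjoint_def by blast
  ultimately show ?thesis using sep R unfolding separated_def by auto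
qed

text \<open>A nonempty \<open>X\<close> makes every member a proper subset of \<open>V\<close>, so
  by \<open>card_inc_gt\<close> each has at least one surplus hyperedge. Summing against
  \<open>separated_cover_sum\<close> bounds their number, and equality leaves no member a second
  surplus.\<close>

lemma separated_cover_bound:
  assumes sep: "separated X \<C>" and cov: "V = X \<union> \<Union>\<C>" and X: "X \<noteq> {}"
  shows "card (inside X) + card \<C> \<le> card X"
    and "card X \<le> card (inside X) + card \<C> \<Longrightarrow> C \<in> \<C> \<Longrightarrow> card (inc C) = card C + 1"
proof -
  have fin: "finite \<C>" using sep separated_finite by blast
  have gt: "card C + 1 \<le> card (inc C)" if "C \<in> \<C>" for C
  proof -
    have "C \<subseteq> V" "C \<noteq> {}" "C \<noteq> V" using sep that X unfolding separated_def by blast+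
    then show ?thesis using card_inc_gt[of C] by simp
  qed
  have le: "(\<Sum>C\<in>\<C>. card C + 1) \<le> (\<Sum>C\<in>\<C>. card (inc C))" by (intro sum_mono gt)
  have eq: "(\<Sum>C\<in>\<C>. card C + 1) = (\<Sum>C\<in>\<C>. card C) + card \<C>" by (subst sum.distrib) simp
  show "card (inside X) + card \<C> \<le> card X"
    using separated_cover_sum[OF sep cov] le eq by linarith
  assume "card X \<le> card (inside X) + card \<C>" and C: "C \<in> \<C>"
  then have "(\<Sum>C\<in>\<C>. card (inc C)) \<le> (\<Sum>C\<in>\<C>. card C + 1)"
    using separated_cover_sum[OF sep cov] eq by linarith
  then have "\<not> (\<Sum>C\<in>\<C>. card C + 1) < (\<Sum>C\<in>\<C>. card (inc C))" by simp
  then have "\<not> card C + 1 < card (inc C)"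
    using sum_strict_mono_ex1[OF fin, of "\<lambda>C. card C + 1" "\<lambda>C. card (inc C)"] gt C by blast
  then show "card (inc C) = card C + 1" using gt[OF C] by simp
qed

text \<open>An uncovered rest counts as one more member, so the bound is strict unless
  \<open>X\<close> and \<open>\<C>\<close> cover \<open>V\<close>.\<close>

lemma separated_bound:
  assumes sep: "separated X \<C>" and X: "X \<noteq> {}"
  shows "card (inside X) + card \<C> \<le> card X"
    and "card X \<le> card (inside X) + card \<C> \<Longrightarrow> V = X \<union> \<Union>\<C>"
proof -
  have fin: "finite \<C>" using sep separated_finite by blast
  define R where "R = V - X - \<Union>\<C>"
  have XV: "X \<subseteq> V" "\<Union>\<C> \<subseteq> V" using sep unfolding separated_def by blast+
  have *: "card (inside X) + card \<C> \<le> card X \<and>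
      (card X \<le> card (inside X) + card \<C> \<longrightarrow> V = X \<union> \<Union>\<C>)"
  proof (cases "R = {}")
    case True
    then have "V = X \<union> \<Union>\<C>" using XV unfolding R_def by blast
    then show ?thesis using separated_cover_bound(1)[OF sep _ X] by blast
  next
    case False
    have "V = X \<union> \<Union>(insert R \<C>)" using XV unfolding R_def by blast
    then have "card (inside X) + card (insert R \<C>) \<le> card X"
      using separated_cover_bound(1)[OF separated_insert_rest[OF sep R_def False] _ X] by blast
    moreover have "R \<notin> \<C>" using False unfolding R_def by blast
    ultimately show ?thesis using fin by simp
  qed
  show "card (inside X) + card \<C> \<le> card X" using * by blast
  show "card X \<le> card (inside X) + card \<C> \<Longrightarrow> V = X \<union> \<Union>\<C>" using * by blast
qed

section \<open>A hyperedge whose removal leaves a perfect matching\<close>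

text \<open>A minimal odd set \<open>K\<close> that exactly three incidences of the incidence graph leave
  cannot coexist with a tight barrier \<open>X\<close> around a hyperedge \<open>h f\<close> with two vertices in \<open>K\<close>:
  every \<open>C \<in> \<C>\<close> accounts for at most two of the incidences between \<open>K \<inter> X\<close> and the
  hyperedges, which leaves \<open>3 * card (K \<inter> X) \<le> 2 + 2 * card (K \<inter> X)\<close>.\<close>

lemma minimal_odd_tight_contradiction:
  assumes KV: "K \<subseteq> V" and oK: "odd (card K)" and iK: "card (inc K) = card K + 1"
    and min: "\<And>A. A \<subseteq> K \<Longrightarrow> odd (card A) \<Longrightarrow> card (inc A) = card A + 1 \<Longrightarrow> A = K"
    and fI: "f \<in> I" and fK: "card (h f \<inter> K) = 2"
    and sep: "separated X \<C>" and cov: "V = X \<union> \<Union>\<C>"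
    and inX: "inside X = {f}" and c2: "2 \<le> card \<C>"
    and tight: "\<And>C. C \<in> \<C> \<Longrightarrow> odd (card C) \<and> card (inc C) = card C + 1"
  shows False
proof -
  have fX: "h f \<subseteq> X" using inX unfolding inside_def by blast
  have XV: "X \<subseteq> V" and CV: "\<And>C. C \<in> \<C> \<Longrightarrow> C \<subseteq> V - X"
    and CX: "\<And>C i. C \<in> \<C> \<Longrightarrow> i \<in> inc C \<Longrightarrow> h i \<subseteq> C \<union> X" and dC: "disjoint \<C>"
    using sep unfolding separated_def by blast+
  have Cdisj: "C \<inter> D = {}" if "C \<in> \<C>" "D \<in> \<C>" "C \<noteq> D" for C D
    using dC that by (meson disjoint_def)
  have finC: "finite \<C>" using sep separated_finite by blast
  have finK: "finite K" using KV fin_sub by blast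
  have fKne: "h f \<inter> K \<noteq> {}" using fK by auto
  have finc: "f \<in> inc K" using fI fKne unfolding inc_def by blast
  have finc': "f \<notin> inc C" if "C \<in> \<C>" for C
    using separated_inside_disjoint[OF sep that] inX by blast
  have notsub: "\<not> K \<subseteq> C" if C: "C \<in> \<C>" for C
    using fKne fX CV[OF C] by blast

  \<comment> \<open>Otherwise a second member \<open>D\<close> would lie in \<open>K\<close>; it is
    odd and tight, so minimality would give \<open>D = K\<close>, contradicting
    \<open>notsub\<close>.\<close>
  have ne: "K \<union> C \<noteq> V" if C: "C \<in> \<C>" for C
  proof
    assume KC: "K \<union> C = V"
    obtain D where D: "D \<in> \<C>" "D \<noteq> C"
    proof -
      have "\<C> \<noteq> {C}" using c2 by auto
      then show thesis using that C by blast
    qed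
    have "D \<inter> C = {}" using Cdisj D C by blast
    then have "D \<subseteq> K" using CV[OF D(1)] KC by blast
    then have "D = K" using min tight[OF D(1)] by blast
    then show False using notsub D(1) by blast
  qed

  define M where "M C = inc K \<inter> inc C" for C
  have finM [simp]: "finite (M C)" for C unfolding M_def by simp
  \<comment> \<open>Uncrossing: \<open>K\<close> and \<open>C\<close> are tight and
    \<open>K \<union> C\<close> has a surplus of at least one, so inclusion-exclusion leaves at most
    a surplus of one for the common hyperedges.\<close>
  have M_le: "card (M C) \<le> card (K \<inter> C) + 1" if C: "C \<in> \<C>" for C
  proof -
    have C': "C \<subseteq> V" "finite C" using CV[OF C] fin_sub by blast+
    have "K \<noteq> {}" using fKne by blast
    then have "card (K \<union> C) < card (inc (K \<union> C))"
      using KV C' ne[OF C] by (intro card_inc_gt) auto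
    moreover have "card (inc K) + card (inc C) = card (inc (K \<union> C)) + card (M C)"
      unfolding inc_Un M_def by (rule card_Un_Int) auto
    moreover have "card K + card C = card (K \<union> C) + card (K \<inter> C)"
      using finK C' by (intro card_Un_Int)
    ultimately show ?thesis using iK tight[OF C] by linarith
  qed
  have inc_Int: "inc (K \<inter> C) \<subseteq> M C" for C
    unfolding M_def using inc_mono[of "K \<inter> C"] by auto
  have inc_Int_gt: "card (K \<inter> C) < card (inc (K \<inter> C))" if C: "C \<in> \<C>" "K \<inter> C \<noteq> {}" for C
    using KV CV[OF C(1)] C(2) notsub[OF C(1)] ne[OF C(1)] by (intro card_inc_gt) auto
  \<comment> \<open>A nonempty intersection is squeezed into tightness, because
    \<open>inc (K \<inter> C)\<close> is contained in \<open>M C\<close>; an odd one would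
    contradict minimality.\<close>
  have ev: "even (card (K \<inter> C))" if C: "C \<in> \<C>" for C
  proof (rule ccontr)
    assume od: "odd (card (K \<inter> C))"
    then have "K \<inter> C \<noteq> {}" by auto
    then have "card (inc (K \<inter> C)) = card (K \<inter> C) + 1"
      using inc_Int_gt[OF C] M_le[OF C] card_mono[OF finM inc_Int[of C]] by linarith
    then have "K \<inter> C = K" using min[of "K \<inter> C"] od by blast
    then show False using notsub[OF C] by blast
  qed

  define k where "k = card (K \<inter> X)"
  have card_K: "card K = k + (\<Sum>C\<in>\<C>. card (K \<inter> C))"
  proof -
    have "K = (K \<inter> X) \<union> (\<Union>C\<in>\<C>. K \<inter> C)" using KV cov by blast
    moreover have "card ((K \<inter> X) \<union> (\<Union>C\<in>\<C>. K \<inter> C)) = k + card (\<Union>C\<in>\<C>. K \<inter> C)"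
      unfolding k_def
    proof (rule card_Un_disjoint)
      show "K \<inter> X \<inter> (\<Union>C\<in>\<C>. K \<inter> C) = {}" using CV by fast
    qed (use finK finC in auto)
    moreover have "card (\<Union>C\<in>\<C>. K \<inter> C) = (\<Sum>C\<in>\<C>. card (K \<inter> C))"
    proof (rule card_UN_disjoint)
      show "\<forall>C\<in>\<C>. \<forall>D\<in>\<C>. C \<noteq> D \<longrightarrow> (K \<inter> C) \<inter> (K \<inter> D) = {}"
      proof (intro ballI impI)
        fix C D assume "C \<in> \<C>" "D \<in> \<C>" "C \<noteq> D"
        then show "(K \<inter> C) \<inter> (K \<inter> D) = {}" using Cdisj[of C D] by blast
      qed
    qed (use finK finC in auto)
    ultimately show ?thesis by simp
  qed
  have "even (\<Sum>C\<in>\<C>. card (K \<inter> C))" using ev by (intro dvd_sum)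
  then have ok: "odd k" using oK card_K by simp
  have k2: "2 \<le> k"
    unfolding k_def using fK fX finK card_mono[of "K \<inter> X" "h f \<inter> K"] by auto

  \<comment> \<open>\<open>f\<close> is the only hyperedge inside \<open>X\<close>; every other one
    meeting \<open>K\<close> reaches some member.\<close>
  have inc_K: "inc K = insert f (\<Union>C\<in>\<C>. M C)"
  proof (rule equalityI; rule subsetI)
    fix i assume i: "i \<in> inc K"
    show "i \<in> insert f (\<Union>C\<in>\<C>. M C)"
    proof (cases "h i \<subseteq> X")
      case True
      then have "i \<in> inside X" using i unfolding inside_def inc_def by blast
      then show ?thesis using inX by simp
    next
      case False
      have iI: "i \<in> I" using i inc_sub by blast
      then obtain C where "C \<in> \<C>" "h i \<inter> C \<noteq> {}" using h_sub[OF iI] cov False by blast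
      then show ?thesis using i iI unfolding M_def inc_def by blast
    qed
  next
    fix i assume "i \<in> insert f (\<Union>C\<in>\<C>. M C)"
    then show "i \<in> inc K" using finc unfolding M_def by blast
  qed
  have f_notin: "f \<notin> (\<Union>C\<in>\<C>. M C)" using finc' unfolding M_def by blast
  have M_disj: "\<forall>C\<in>\<C>. \<forall>D\<in>\<C>. C \<noteq> D \<longrightarrow> M C \<inter> M D = {}"
    using separated_inc_disjoint[OF sep] unfolding M_def by blast
  have sum_inc_K: "(\<Sum>i\<in>inc K. w i) = w f + (\<Sum>C\<in>\<C>. \<Sum>i\<in>M C. w i)" for w :: "'i \<Rightarrow> nat"
  proof -
    have "(\<Sum>i\<in>inc K. w i) = w f + (\<Sum>i\<in>(\<Union>C\<in>\<C>. M C). w i)"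
      unfolding inc_K using finC f_notin by (subst sum.insert) auto
    also have "(\<Sum>i\<in>(\<Union>C\<in>\<C>. M C). w i) = (\<Sum>C\<in>\<C>. \<Sum>i\<in>M C. w i)"
      using finC M_disj by (intro sum.UNION_disjoint) auto
    finally show ?thesis .
  qed
  \<comment> \<open>The hyperedge \<open>f\<close>, which is in no \<open>M C\<close>, accounts for
    the surplus of \<open>K\<close>.\<close>
  have card_M: "(\<Sum>C\<in>\<C>. card (M C)) = k + (\<Sum>C\<in>\<C>. card (K \<inter> C))"
    using sum_inc_K[of "\<lambda>_. 1"] iK card_K by simp

  \<comment> \<open>If no hyperedge of \<open>M C\<close> left \<open>K\<close>, the parts of
    \<open>C\<close> inside and outside \<open>K\<close> would share no hyperedge. Each part has a
    surplus, so \<open>C\<close> would have a surplus of two.\<close>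
  have leave: "\<exists>i\<in>M C. \<not> h i \<subseteq> K" if C: "C \<in> \<C>" and Mne: "M C \<noteq> {}" for C
  proof (rule ccontr)
    assume "\<not> (\<exists>i\<in>M C. \<not> h i \<subseteq> K)"
    then have all: "\<And>i. i \<in> M C \<Longrightarrow> h i \<subseteq> K" by blast
    define A B where "A = K \<inter> C" and "B = C - K"
    have CAB: "C = A \<union> B" "A \<inter> B = {}" unfolding A_def B_def by blast+
    have C': "C \<subseteq> V" "finite C" using CV[OF C] fin_sub by blast+
    obtain i where i: "i \<in> M C" using Mne by blast
    have Ane: "A \<noteq> {}" using all[OF i] i unfolding A_def M_def inc_def by blast
    have Bne: "B \<noteq> {}"
    proof
      assume "B = {}"
      then have "C \<subseteq> K" unfolding B_def by blast
      then have "C = K" using min tight[OF C] by blast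
      then show False using notsub[OF C] by blast
    qed
    have "inc A \<inter> inc B = {}"
    proof (rule equals0I)
      fix j assume j: "j \<in> inc A \<inter> inc B"
      then have "j \<in> M C" using inc_Int[of C] unfolding A_def by blast
      then show False using all[of j] j unfolding B_def inc_def by blast
    qed
    then have "card (inc C) = card (inc A) + card (inc B)"
      unfolding CAB(1) inc_Un by (intro card_Un_disjoint) auto
    moreover have "card C = card A + card B"
      using C'(2) CAB(2) unfolding CAB(1) by (intro card_Un_disjoint) auto
    moreover have "card A < card (inc A)" unfolding A_def
      using inc_Int_gt[OF C] Ane unfolding A_def by blast
    moreover have "card B < card (inc B)"
      using C' Bne Ane CAB by (intro card_inc_gt) blast+
    ultimately show False using tight[OF C] by linarith
  qed

  \<comment> \<open>By \<open>leave\<close>, the hyperedges of \<open>M C\<close> have fewer than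
    \<open>3 * card (M C)\<close> incidences with \<open>K\<close>; exactly
    \<open>3 * card (K \<inter> C)\<close> of them lie in \<open>C\<close>. Then \<open>M_le\<close>
    lowers the factor three to two.\<close>
  have two: "(\<Sum>i\<in>M C. card (h i \<inter> (K \<inter> X))) + 2 * card (K \<inter> C) \<le> 2 * card (M C)"
    if C: "C \<in> \<C>" for C
  proof (cases "M C = {}")
    case True
    then have "inc (K \<inter> C) = {}" using inc_Int[of C] by blast
    then have "K \<inter> C = {}" using inc_Int_gt[OF C] by auto
    then show ?thesis using True by simp
  next
    case False
    have MI: "M C \<subseteq> I" unfolding M_def using inc_sub by blast
    have "(\<Sum>i\<in>M C. card (h i \<inter> (K \<inter> X))) + (\<Sum>i\<in>M C. card (h i \<inter> (K \<inter> C)))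
        = (\<Sum>i\<in>M C. card (h i \<inter> (K \<inter> X)) + card (h i \<inter> (K \<inter> C)))"
      by (simp add: sum.distrib)
    also have "\<dots> = (\<Sum>i\<in>M C. card (h i \<inter> K))"
    proof (intro sum.cong refl)
      fix i assume i: "i \<in> M C"
      have "h i \<subseteq> C \<union> X" using CX[OF C] i unfolding M_def by blast
      then have "h i \<inter> K = (h i \<inter> (K \<inter> X)) \<union> (h i \<inter> (K \<inter> C))" by blast
      moreover have "card ((h i \<inter> (K \<inter> X)) \<union> (h i \<inter> (K \<inter> C)))
          = card (h i \<inter> (K \<inter> X)) + card (h i \<inter> (K \<inter> C))"
      proof (rule card_Un_disjoint)
        show "(h i \<inter> (K \<inter> X)) \<inter> (h i \<inter> (K \<inter> C)) = {}" using CV[OF C] by blast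
      qed (use finK in auto)
      ultimately show "card (h i \<inter> (K \<inter> X)) + card (h i \<inter> (K \<inter> C)) = card (h i \<inter> K)" by simp
    qed
    also have "\<dots> < (\<Sum>i\<in>M C. 3)"
    proof (rule sum_strict_mono_ex1)
      show "\<forall>i\<in>M C. card (h i \<inter> K) \<le> 3" using card_Int_h_le MI by blast
      obtain i where i: "i \<in> M C" "\<not> h i \<subseteq> K" using leave[OF C False] by blast
      have iI: "i \<in> I" using i(1) MI by blast
      have "h i \<inter> K \<subset> h i" using i(2) by blast
      then have "card (h i \<inter> K) < 3" using h_card[OF iI] fin_h[OF iI] psubset_card_mono by metis
      then show "\<exists>i\<in>M C. card (h i \<inter> K) < 3" using i(1) by blast
    qed simp
    finally have lt: "(\<Sum>i\<in>M C. card (h i \<inter> (K \<inter> X))) + (\<Sum>i\<in>M C. card (h i \<inter> (K \<inter> C)))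
        < 3 * card (M C)" by simp
    have "(\<Sum>i\<in>M C. card (h i \<inter> (K \<inter> C))) = 3 * card (K \<inter> C)"
      using KV inc_Int MI by (intro sum_card_Int) auto
    then show ?thesis using lt M_le[OF C] by linarith
  qed

  \<comment> \<open>The incidences of \<open>K \<inter> X\<close> are counted over
    \<open>inc K\<close>: \<open>f\<close> contributes two, and the members at most
    \<open>2 * k\<close> by \<open>two\<close> and \<open>card_M\<close>. Hence \<open>k\<close> is
    at most two, against \<open>k2\<close> and \<open>ok\<close>.\<close>
  have "inc (K \<inter> X) \<subseteq> inc K" by (rule inc_mono) blast
  then have "3 * k = (\<Sum>i\<in>inc K. card (h i \<inter> (K \<inter> X)))"
    unfolding k_def using KV inc_sub by (subst sum_card_Int) auto
  also have "\<dots> = card (h f \<inter> (K \<inter> X)) + (\<Sum>C\<in>\<C>. \<Sum>i\<in>M C. card (h i \<inter> (K \<inter> X)))"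
    by (rule sum_inc_K)
  also have "h f \<inter> (K \<inter> X) = h f \<inter> K" using fX by blast
  finally have "3 * k = 2 + (\<Sum>C\<in>\<C>. \<Sum>i\<in>M C. card (h i \<inter> (K \<inter> X)))" using fK by simp
  moreover have "(\<Sum>C\<in>\<C>. \<Sum>i\<in>M C. card (h i \<inter> (K \<inter> X))) + 2 * (\<Sum>C\<in>\<C>. card (K \<inter> C))
      \<le> 2 * (\<Sum>C\<in>\<C>. card (M C))"
    using sum_mono[of \<C>, OF two] by (simp add: sum.distrib sum_distrib_left)
  ultimately have "k \<le> 2" using card_M by linarith
  then show False using k2 ok by (cases "k = 2") auto
qed

text \<open>Otherwise every hyperedge meeting \<open>K\<close> does so in one or three vertices, so
  the \<open>3 * card K\<close> incidences have the parity of \<open>card (inc K)\<close>, which is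
  opposite to that of \<open>card K\<close>.\<close>

lemma exists_hyperedge_meeting_in_two:
  assumes KV: "K \<subseteq> V" and iK: "card (inc K) = card K + 1"
  shows "\<exists>f\<in>I. card (h f \<inter> K) = 2"
proof (rule ccontr)
  assume no: "\<not> (\<exists>f\<in>I. card (h f \<inter> K) = 2)"
  have "odd (card (h i \<inter> K))" if i: "i \<in> inc K" for i
  proof -
    have iI: "i \<in> I" using i inc_sub by blast
    have "h i \<inter> K \<noteq> {}" "finite (h i \<inter> K)" using i fin_h[OF iI] unfolding inc_def by auto
    then have "card (h i \<inter> K) \<noteq> 0" by simp
    moreover have "card (h i \<inter> K) \<noteq> 2" using no iI by blast
    ultimately have "card (h i \<inter> K) = 1 \<or> card (h i \<inter> K) = 3" using card_Int_h_le[OF iI, of K] by linarith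
    then show ?thesis by auto
  qed
  then have "{i \<in> inc K. odd (card (h i \<inter> K))} = inc K" by blast
  then have "even (\<Sum>i\<in>inc K. card (h i \<inter> K)) \<longleftrightarrow> even (card (inc K))"
    by (simp add: even_sum_iff)
  then show False using sum_card_Int[OF KV order_refl inc_sub] iK by simp
qed

text \<open>The excluded pairs are the barriers that Tutte's theorem would give for
  \<open>V - h f\<close>, enlarged by the vertices of \<open>h f\<close>. If every hyperedge had
  one, equality in \<open>separated_bound\<close> would make all members odd and tight, and a
  smallest odd tight set gives the contradiction.\<close>

theorem exists_hyperedge_outside_barriers:
  assumes "V \<noteq> {}"
  shows "\<exists>f\<in>I. \<nexists>X \<C>. separated X \<C> \<and> h f \<subseteq> X \<and> (\<forall>C\<in>\<C>. odd (card C)) \<and> card X \<le> card \<C> + 1"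
proof (rule ccontr)
  assume "\<not> ?thesis"
  then have barrier: "\<exists>X \<C>. separated X \<C> \<and> h f \<subseteq> X \<and> (\<forall>C\<in>\<C>. odd (card C)) \<and> card X \<le> card \<C> + 1"
    if "f \<in> I" for f using that by blast
  have tight_barrier: "\<exists>X \<C>. separated X \<C> \<and> V = X \<union> \<Union>\<C> \<and> inside X = {f} \<and> 2 \<le> card \<C> \<and>
      (\<forall>C\<in>\<C>. odd (card C) \<and> card (inc C) = card C + 1)" if f: "f \<in> I" for f
  proof -
    obtain X \<C> where sep: "separated X \<C>" and fX: "h f \<subseteq> X" and od: "\<forall>C\<in>\<C>. odd (card C)"
      and le: "card X \<le> card \<C> + 1" using barrier[OF f] by blast
    have XV: "X \<subseteq> V" using sep unfolding separated_def by blast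
    \<comment> \<open>With \<open>le\<close>, this also guarantees two members in
      \<open>\<C>\<close>.\<close>
    have c3: "3 \<le> card X" using card_mono[OF fin_sub[OF XV] fX] h_card[OF f] by simp
    have Xne: "X \<noteq> {}" using c3 by auto
    have fin: "finite (inside X)" using finI unfolding inside_def by simp
    have fin_side: "f \<in> inside X" using f fX unfolding inside_def by blast
    then have "card (inside X) \<noteq> 0" using fin by auto
    \<comment> \<open>The hyperedge \<open>f\<close> inside \<open>X\<close> uses up the one unit by
      which \<open>card X\<close> may exceed \<open>card \<C>\<close>.\<close>
    then have ge: "card X \<le> card (inside X) + card \<C>" using le by linarith
    have cov: "V = X \<union> \<Union>\<C>" using separated_bound(2)[OF sep Xne ge] .
    have "card (inside X) = 1"
      using separated_bound(1)[OF sep Xne] le \<open>card (inside X) \<noteq> 0\<close> by linarith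
    then have "inside X = {f}" using fin_side by (metis card_1_singletonE singletonD)
    then show ?thesis
      using sep cov od c3 le separated_cover_bound(2)[OF sep cov Xne ge]
      by (intro exI[of _ X] exI[of _ \<C>]) auto
  qed
  define P where "P K \<longleftrightarrow> K \<subseteq> V \<and> odd (card K) \<and> card (inc K) = card K + 1" for K
  have "\<exists>K. P K"
  proof -
    have "card I \<noteq> 0" using card_I assms finV by simp
    then obtain f where "f \<in> I" by fastforce
    then obtain X \<C> where sep: "separated X \<C>" and c2: "2 \<le> card \<C>"
      and t: "\<forall>C\<in>\<C>. odd (card C) \<and> card (inc C) = card C + 1" using tight_barrier by blast
    have "\<C> \<noteq> {}" using c2 by auto
    then obtain C where C: "C \<in> \<C>" by blast
    then have "C \<subseteq> V" using sep unfolding separated_def by blast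
    then show ?thesis unfolding P_def using t C by blast
  qed
  then obtain K where K: "P K" and Kmin: "\<And>A. P A \<Longrightarrow> card K \<le> card A"
    using ex_has_least_nat[of P _ card] by blast
  have KV: "K \<subseteq> V" using K unfolding P_def by blast
  obtain f where f: "f \<in> I" "card (h f \<inter> K) = 2"
    using exists_hyperedge_meeting_in_two K unfolding P_def by blast
  obtain X \<C> where X: "separated X \<C>" "V = X \<union> \<Union>\<C>" "inside X = {f}" "2 \<le> card \<C>"
      "\<And>C. C \<in> \<C> \<Longrightarrow> odd (card C) \<and> card (inc C) = card C + 1"
    using tight_barrier[OF f(1)] by blast
  \<comment> \<open>A set of smallest cardinality is also minimal under inclusion.\<close>
  have "A = K" if "A \<subseteq> K" "odd (card A)" "card (inc A) = card A + 1" for A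
  proof -
    have "P A" using that KV unfolding P_def by blast
    then show ?thesis using Kmin that(1) fin_sub[OF KV] by (intro card_subset_eq) (auto intro: antisym card_mono)
  qed
  then show False
    using minimal_odd_tight_contradiction[OF KV _ _ _ f X] K unfolding P_def by blast
qed

section \<open>From barriers in the graph to separated families\<close>

definition pairs :: "'a set set" where
  "pairs = {f. card f = 2 \<and> (\<exists>i\<in>I. f \<subseteq> h i)}"

text \<open>The deleted vertices join the barrier. A hyperedge that meets \<open>C\<close> and has a
  vertex outside \<open>C \<union> (X \<union> S)\<close> would contain an edge from
  \<open>C\<close> to that vertex, which \<open>X\<close> excludes.\<close>

lemma odd_separated_imp_separated:
  assumes SV: "S \<subseteq> V" and os: "odd_separated pairs (V - S) X \<C>"
  shows "separated (X \<union> S) \<C>"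
proof -
  have C: "\<And>C. C \<in> \<C> \<Longrightarrow> C \<subseteq> V - S - X \<and> odd (card C)" and X: "X \<subseteq> V - S" and dC: "disjoint \<C>"
    and sep: "\<And>C f. C \<in> \<C> \<Longrightarrow> f \<in> pairs \<Longrightarrow> f \<subseteq> V - S \<Longrightarrow> f \<inter> C \<noteq> {} \<Longrightarrow> f \<subseteq> C \<union> X"
    using os unfolding odd_separated_def by blast+
  have "h i \<subseteq> C \<union> (X \<union> S)" if CC: "C \<in> \<C>" and i: "i \<in> inc C" for C i
  proof
    fix z assume z: "z \<in> h i"
    obtain d where d: "d \<in> h i" "d \<in> C" and iI: "i \<in> I" using i unfolding inc_def by blast
    show "z \<in> C \<union> (X \<union> S)"
    proof (rule ccontr)
      assume nz: "z \<notin> C \<union> (X \<union> S)"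
      have "d \<noteq> z" using d nz by blast
      then have "{d, z} \<in> pairs" unfolding pairs_def using d z iI by auto
      moreover have "{d, z} \<subseteq> V - S" using h_sub[OF iI] z d C[OF CC] nz by blast
      ultimately show False using sep[OF CC, of "{d, z}"] d(2) nz by blast
    qed
  qed
  moreover have "C \<noteq> {} \<and> C \<subseteq> V - (X \<union> S)" if "C \<in> \<C>" for C using C[OF that] by auto
  ultimately show ?thesis unfolding separated_def using X SV dC by blast
qed

lemma not_matchable_barrier:
  assumes SV: "S \<subseteq> V" and ev: "even (card (V - S))" and no: "\<not> matchable pairs (V - S)"
  shows "\<exists>X \<C>. separated X \<C> \<and> S \<subseteq> X \<and> (\<forall>C\<in>\<C>. odd (card C)) \<and> card X + 2 \<le> card \<C> + card S"
proof -
  obtain X \<C> where os: "odd_separated pairs (V - S) X \<C>" and le: "card X + 2 \<le> card \<C>"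
    using even_not_matchable[OF _ _ ev no] finV unfolding pairs_def by auto
  have "card (X \<union> S) \<le> card X + card S" by (rule card_Un_le)
  moreover have "\<forall>C\<in>\<C>. odd (card C)" using os unfolding odd_separated_def by blast
  ultimately show ?thesis
    using odd_separated_imp_separated[OF SV os] le
    by (intro exI[of _ "X \<union> S"] exI[of _ \<C>]) auto
qed

text \<open>An empty \<open>S\<close> serves perfect matchings of the whole graph, a singleton
  serves factor-criticality. The excess of the barrier contradicts \<open>separated_bound\<close>
  unless \<open>X\<close> is empty.\<close>

lemma matchable_Diff:
  assumes SV: "S \<subseteq> V" and S1: "card S \<le> 1" and ev: "even (card (V - S))"
  shows "matchable pairs (V - S)"
proof (rule ccontr)
  assume "\<not> matchable pairs (V - S)"
  then obtain X \<C> where sep: "separated X \<C>" and SX: "S \<subseteq> X" and od: "\<forall>C\<in>\<C>. odd (card C)"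
    and le: "card X + 2 \<le> card \<C> + card S"
    using not_matchable_barrier[OF SV ev] by blast
  show False
  proof (cases "X = {}")
    case False
    then show ?thesis using separated_bound(1)[OF sep False] le S1 by linarith
  next
    case True
    then have Se: "S = {}" using SX by blast
    then have "\<C> \<noteq> {}" using le by auto
    then obtain C where C: "C \<in> \<C>" by blast
    \<comment> \<open>With an empty barrier a member is closed under hyperedges, so connectedness
      makes it all of \<open>V\<close>; but it is odd and \<open>V\<close> is even.\<close>
    have cl: "C \<noteq> {}" "C \<subseteq> V" "\<And>i. i \<in> inc C \<Longrightarrow> h i \<subseteq> C"
      using sep C True unfolding separated_def by blast+
    have "C \<noteq> V" using od C ev Se by auto
    then show False using conn[OF cl(2,1)] cl(3) unfolding inc_def by blast
  qed
qed

text \<open>Removing three vertices makes the rest even, so failure would give a barrier of excess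
  two; once it absorbs \<open>h f\<close> it is one of those that \<open>nb\<close>
  excludes.\<close>

lemma exists_hyperedge_matchable_rest:
  assumes od: "odd (card V)"
  shows "\<exists>f\<in>I. matchable pairs (V - h f)"
proof -
  have "V \<noteq> {}" using od by auto
  then obtain f where f: "f \<in> I"
    and nb: "\<nexists>X \<C>. separated X \<C> \<and> h f \<subseteq> X \<and> (\<forall>C\<in>\<C>. odd (card C)) \<and> card X \<le> card \<C> + 1"
    using exists_hyperedge_outside_barriers by blast
  have "card (V - h f) = card V - 3"
    using card_Diff_subset[OF fin_h[OF f] h_sub[OF f]] h_card[OF f] by simp
  moreover have "3 \<le> card V" using card_mono[OF finV h_sub[OF f]] h_card[OF f] by simp
  ultimately have ev: "even (card (V - h f))" using od by simp
  have "matchable pairs (V - h f)"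
  proof (rule ccontr)
    assume "\<not> ?thesis"
    from not_matchable_barrier[OF h_sub[OF f] ev this] obtain X \<C>
      where "separated X \<C>" "h f \<subseteq> X" "\<forall>C\<in>\<C>. odd (card C)" "card X + 2 \<le> card \<C> + card (h f)"
      by blast
    moreover from this(4) have "card X \<le> card \<C> + 1" using h_card[OF f] by linarith
    ultimately show False using nb by blast
  qed
  then show ?thesis using f by blast
qed

end

section \<open>Transfer to multisets of hyperedges and to \<open>two_graph\<close>\<close>

lemma hyper_connected_crossing:
  assumes "hyper_connected V E" and "A \<subseteq> V" "A \<noteq> {}" "A \<noteq> V"
  shows "\<exists>e\<in>#E. e \<inter> A \<noteq> {} \<and> \<not> e \<subseteq> A"
proof (rule ccontr)
  assume no: "\<not> (\<exists>e\<in>#E. e \<inter> A \<noteq> {} \<and> \<not> e \<subseteq> A)"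
  obtain u v where uv: "u \<in> A" "v \<in> V" "v \<notin> A" using assms(2-4) by blast
  then have "(u, v) \<in> {(x, y). \<exists>e \<in># E. x \<in> e \<and> y \<in> e}\<^sup>*"
    using assms(1,2) unfolding hyper_connected_def by blast
  \<comment> \<open>Without a crossing hyperedge, a chain that starts in \<open>A\<close> never
    leaves it.\<close>
  then have "v \<in> A"
    by (induction rule: rtrancl_induct) (use uv(1) no in blast)+
  then show False using uv(3) by blast
qed

lemma perfect_matching_delete_verts:
  assumes "M \<subseteq> edges G" and "partition_on (verts G - S) M"
  shows "perfect_matching (delete_verts G S) M"
proof -
  have "f \<inter> S = {}" if "f \<in> M" for f using partition_onD1[OF assms(2)] that by blast
  then show ?thesis
    using assms partition_onD2[OF assms(2)]
    unfolding perfect_matching_def matching_def delete_verts_def verts_def edges_def by auto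
qed

theorem theorem3p1:
  fixes V :: "'a set" and E :: "'a set multiset"
  assumes "hypergraph V E"
    and "hyper_connected V E"
    and "uniform 3 E"
    and "regular 3 V E"
  shows "(even (card V) \<longrightarrow> has_perfect_matching (two_graph V E)) \<and>
         (odd (card V) \<longrightarrow>
            factor_critical (two_graph V E) \<and>
            (\<exists>a b c M. is_triangle E {a, b, c} \<and>
               perfect_matching (delete_verts (two_graph V E) {a, b, c}) M \<and>
               partition_on V (insert {a, b, c} M)))"
proof -
  \<comment> \<open>Positions in an enumerating list serve as indices, so repeated hyperedges stay
    distinct.\<close>
  obtain es where es: "mset es = E" using ex_mset by blast
  define I where "I = {..<length es}"
  have E_set: "set_mset E = (!) es ` I"
    unfolding es[symmetric] I_def by (auto simp: in_set_conv_nth)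
  interpret connected_cubic_hypergraph V I "(!) es"
  proof
    show "finite V" using assms(1) unfolding hypergraph_def by blast
    show "finite I" unfolding I_def by simp
    show "es ! i \<subseteq> V" if "i \<in> I" for i using assms(1) that unfolding hypergraph_def by (simp add: E_set)
    show "card (es ! i) = 3" if "i \<in> I" for i using assms(3) that unfolding uniform_def by (simp add: E_set)
    show "card {i \<in> I. v \<in> es ! i} = 3" if "v \<in> V" for v
    proof -
      have "hyperdegree E v = length (filter (\<lambda>e. v \<in> e) es)"
        unfolding hyperdegree_def es[symmetric] by (simp flip: mset_filter)
      also have "\<dots> = card {i \<in> I. v \<in> es ! i}"
        unfolding I_def by (simp add: length_filter_conv_card)
      finally show ?thesis using assms(4) that unfolding regular_def by simp
    qed
    show "\<exists>i\<in>I. es ! i \<inter> A \<noteq> {} \<and> \<not> es ! i \<subseteq> A" if A: "A \<subseteq> V" "A \<noteq> {}" "A \<noteq> V" for A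
    proof -
      obtain e where "e \<in># E" "e \<inter> A \<noteq> {}" "\<not> e \<subseteq> A"
        using hyper_connected_crossing[OF assms(2) A] by blast
      then show ?thesis by (auto simp: E_set)
    qed
  qed
  let ?G = "two_graph V E"
  have G: "verts ?G = V" "edges ?G = pairs"
    unfolding two_graph_def verts_def edges_def pairs_def by (simp_all add: E_set)
  have pm: "\<exists>M. perfect_matching (delete_verts ?G S) M \<and> partition_on (V - S) M"
    if "matchable pairs (V - S)" for S
    using that perfect_matching_delete_verts[of _ ?G S] G unfolding matchable_def by metis
  have G0: "delete_verts ?G {} = ?G"
    unfolding delete_verts_def verts_def edges_def by simp
  have even_case: "has_perfect_matching ?G" if "even (card V)"
    using matchable_Diff[of "{}"] pm[of "{}"] that G0 unfolding has_perfect_matching_def by auto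
  have critical: "factor_critical ?G" if od: "odd (card V)"
    unfolding factor_critical_def G(1)
  proof
    fix v assume v: "v \<in> V"
    then have "even (card (V - {v}))" using od finV by (simp add: card_Diff_singleton)
    then have "matchable pairs (V - {v})" using v by (intro matchable_Diff) auto
    then show "has_perfect_matching (delete_verts ?G {v})"
      using pm unfolding has_perfect_matching_def by blast
  qed
  have triangle: "\<exists>a b c M. is_triangle E {a, b, c} \<and> perfect_matching (delete_verts ?G {a, b, c}) M \<and>
      partition_on V (insert {a, b, c} M)" if od: "odd (card V)"
  proof -
    obtain i where i: "i \<in> I" and m: "matchable pairs (V - es ! i)"
      using exists_hyperedge_matchable_rest[OF od] by blast
    obtain M where M: "perfect_matching (delete_verts ?G (es ! i)) M" "partition_on (V - es ! i) M"
      using pm[OF m] by blast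
    obtain a b c where abc: "es ! i = {a, b, c}" using h_card[OF i] by (auto simp: card_3_iff)
    have "disjnt (es ! i) (\<Union>M)" using partition_onD1[OF M(2)] unfolding disjnt_def by blast
    then have "partition_on V (insert (es ! i) M)"
      using M(2) h_sub[OF i] abc by (subst partition_on_insert) auto
    moreover have "is_triangle E (es ! i)" using i h_card[OF i] unfolding is_triangle_def by (simp add: E_set)
    ultimately show ?thesis using M(1) unfolding abc by blast
  qed
  show ?thesis using even_case critical triangle by blast
qed

end
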